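(* Let $L_0$ be the space of (classes of) Lebesgue measurable functions $[0,1]\to\mathbb{R}$, where functions equal a.e. are identified, with the topology of convergence in measure, and endow $L_0^{\mathbb{N}}$ with the product topology. Let $NUP([0,1])\subset L_0^{\mathbb{N}}$ be the family of sequences $(f_n)_n$ such that (A) $f_n\to 0$ pointwise a.e. in $[0,1]$; (B) for every $\varepsilon>0$ there is a measurable set $E\subset[0,1]$ such that $m(E)<\varepsilon$ and $\operatorname{ess\,sup}_{[0,1]\setminus E}|f_n|\to 0$ as $n\to\infty$; (C) $(f_n)_n$ does not converge uniformly a.e. in $[0,1]$. Then $NUP([0,1])$ is spaceable in $L_0^{\mathbb{N}}$.
   Context: $m$ is Lebesgue measure on $[0,1]$. The topology on $L_0$ is the one given by the metric $\rho(f,g)=\int_{[0,1]}\frac{|f(x)-g(x)|}{1+|f(x)-g(x)|}\,dx$, for which $\rho(f_n,f)\to0$ if and only if $f_n\to f$ in measure. The topology on $L_0^{\mathbb{N}}$ is the one given by the product metric $D((f_n)_n,(g_n)_n)=\sum_{n=1}^\infty \frac{1}{2^n}\cdot\frac{\rho(f_n,g_n)}{1+\rho(f_n,g_n)}$; with it $L_0^{\mathbb{N}}$ is a separable, complete metrizable topological vector space (with coordinatewise operations). For $A\subset[0,1]$ measurable, $\operatorname{ess\,sup}_{A} f:=\inf\{\alpha\in\mathbb{R}: m(\{x\in A: f(x)>\alpha\})=0\}$. A sequence $(f_n)_n$ converges to $f$ uniformly a.e. in $[0,1]$ if there is $E\subset[0,1]$ with $m(E)=0$ such that $f_n\to f$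 uniformly on $[0,1]\setminus E$. A subset $A$ of a topological vector space $X$ is spaceable in $X$ if there exists a closed infinite dimensional vector subspace $M$ of $X$ such that $M\setminus\{0\}\subset A$. *)

theory Defs
  imports "HOL-Probability.Essential_Supremum" "HOL-Library.Function_Algebras"
begin

section \<open>The space of classes of measurable functions on the unit interval\<close>

text \<open>Representatives are functions \<open>real \<Rightarrow> real\<close> whose values outside
  \<open>[0,1]\<close> are irrelevant: both measurability and equality a.e. refer to Lebesgue
  measure restricted to \<open>[0,1]\<close>.\<close>

abbreviation I01 :: "real measure" where
  "I01 \<equiv> lebesgue_on {0..1}"

definition ae_eq01 :: "(real \<Rightarrow> real) \<Rightarrow> (real \<Rightarrow> real) \<Rightarrow> bool" where
  "ae_eq01 f g \<longleftrightarrow>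
     f \<in> borel_measurable I01 \<and> g \<in> borel_measurable I01 \<and> (AE x in I01. f x = g x)"

quotient_type L0 = "real \<Rightarrow> real" / partial: ae_eq01
proof (rule part_equivpI)
  have "ae_eq01 (\<lambda>_. 0) (\<lambda>_. 0)"
    by (simp add: ae_eq01_def)
  then show "\<exists>f. ae_eq01 f f"
    by blast
  show "symp ae_eq01"
    by (rule sympI) (auto simp: ae_eq01_def)
  show "transp ae_eq01"
    by (rule transpI) (auto simp: ae_eq01_def)
qed

lemma ae_eq01_sym: "ae_eq01 f g \<Longrightarrow> ae_eq01 g f"
  by (auto simp: ae_eq01_def)

lemma ae_eq01_common:
  assumes "\<And>n::nat. ae_eq01 (F n) (G n)"
  shows "AE x in I01. \<forall>n. F n x = G n x"
  using assms by (simp add: ae_eq01_def AE_all_countable)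

instantiation L0 :: real_vector
begin

lift_definition zero_L0 :: L0 is "\<lambda>_. 0"
  by (simp add: ae_eq01_def)

lift_definition plus_L0 :: "L0 \<Rightarrow> L0 \<Rightarrow> L0" is "\<lambda>f g x. f x + g x"
  by (auto simp: ae_eq01_def)

lift_definition minus_L0 :: "L0 \<Rightarrow> L0 \<Rightarrow> L0" is "\<lambda>f g x. f x - g x"
  by (auto simp: ae_eq01_def)

lift_definition uminus_L0 :: "L0 \<Rightarrow> L0" is "\<lambda>f x. - f x"
  by (auto simp: ae_eq01_def)

lift_definition scaleR_L0 :: "real \<Rightarrow> L0 \<Rightarrow> L0" is "\<lambda>c f x. c * f x"
  by (auto simp: ae_eq01_def)

instance
  by standard (transfer; auto simp: ae_eq01_def algebra_simps)+

end

lemma frac_le_1: "\<bar>t\<bar> / (1 + \<bar>t\<bar>) \<le> (1::real)"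
  by (simp add: divide_simps)

lemma frac_triangle:
  fixes a b c :: real
  assumes "0 \<le> a" "0 \<le> b" "0 \<le> c" "a \<le> b + c"
  shows "a / (1 + a) \<le> b / (1 + b) + c / (1 + c)"
proof -
  have "a / (1 + a) \<le> (b + c) / (1 + (b + c))"
    using assms by (simp add: divide_simps algebra_simps)
  also have "\<dots> = b / (1 + (b + c)) + c / (1 + (b + c))"
    by (simp add: add_divide_distrib)
  also have "\<dots> \<le> b / (1 + b) + c / (1 + c)"
    using assms by (intro add_mono divide_left_mono) auto
  finally show ?thesis .
qed

lemma finite_measure_I01: "finite_measure I01"
  by (rule finite_measureI) (simp add: space_restrict_space emeasure_restrict_space)

lemma integrable_frac:
  fixes f g :: "real \<Rightarrow> real"
  assumes "f \<in> borel_measurable I01" "g \<in> borel_measurable I01"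
  shows "integrable I01 (\<lambda>x. \<bar>f x - g x\<bar> / (1 + \<bar>f x - g x\<bar>))"
proof -
  interpret finite_measure I01 by (rule finite_measure_I01)
  have "(\<lambda>x. \<bar>f x - g x\<bar> / (1 + \<bar>f x - g x\<bar>)) \<in> borel_measurable I01"
    by (intro borel_measurable_divide borel_measurable_add borel_measurable_abs
        borel_measurable_diff borel_measurable_const assms)
  then show ?thesis
    by (intro integrable_const_bound[where B = 1]) (simp_all add: frac_le_1)
qed

instantiation L0 :: metric_space
begin

lift_definition dist_L0 :: "L0 \<Rightarrow> L0 \<Rightarrow> real" is
  "\<lambda>f g. \<integral>x. \<bar>f x - g x\<bar> / (1 + \<bar>f x - g x\<bar>) \<partial>I01"
  by (rule integral_cong_AE) (auto simp: ae_eq01_def)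

definition uniformity_L0 :: "(L0 \<times> L0) filter" where
  "uniformity_L0 = (INF e\<in>{0<..}. principal {(x, y). dist x y < e})"

definition open_L0 :: "L0 set \<Rightarrow> bool" where
  "open_L0 U \<longleftrightarrow> (\<forall>x\<in>U. \<forall>\<^sub>F (x', y) in uniformity. x' = x \<longrightarrow> y \<in> U)"

instance
proof
  fix x y z :: L0
  show "dist x y = 0 \<longleftrightarrow> x = y"
  proof transfer
    fix f g assume "ae_eq01 f f" "ae_eq01 g g"
    then have m: "f \<in> borel_measurable I01" "g \<in> borel_measurable I01"
      by (auto simp: ae_eq01_def)
    have "(\<integral>x. \<bar>f x - g x\<bar> / (1 + \<bar>f x - g x\<bar>) \<partial>I01) = 0 \<longleftrightarrow>
        (AE x in I01. \<bar>f x - g x\<bar> / (1 + \<bar>f x - g x\<bar>) = 0)"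
      by (intro integral_nonneg_eq_0_iff_AE integrable_frac m) auto
    also have "\<dots> \<longleftrightarrow> (AE x in I01. f x = g x)"
      by (intro AE_cong) (auto simp: add_nonneg_eq_0_iff)
    finally show "(\<integral>x. \<bar>f x - g x\<bar> / (1 + \<bar>f x - g x\<bar>) \<partial>I01) = 0 \<longleftrightarrow> ae_eq01 f g"
      using m by (simp add: ae_eq01_def)
  qed
  show "dist x y \<le> dist x z + dist y z"
  proof transfer
    fix f g h assume "ae_eq01 f f" "ae_eq01 g g" "ae_eq01 h h"
    then have m: "f \<in> borel_measurable I01" "g \<in> borel_measurable I01" "h \<in> borel_measurable I01"
      by (auto simp: ae_eq01_def)
    have "(\<integral>x. \<bar>f x - g x\<bar> / (1 + \<bar>f x - g x\<bar>) \<partial>I01) \<le>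
        (\<integral>x. \<bar>f x - h x\<bar> / (1 + \<bar>f x - h x\<bar>) + \<bar>g x - h x\<bar> / (1 + \<bar>g x - h x\<bar>) \<partial>I01)"
      by (intro integral_mono Bochner_Integration.integrable_add integrable_frac m frac_triangle) auto
    then show "(\<integral>x. \<bar>f x - g x\<bar> / (1 + \<bar>f x - g x\<bar>) \<partial>I01) \<le>
        (\<integral>x. \<bar>f x - h x\<bar> / (1 + \<bar>f x - h x\<bar>) \<partial>I01) +
        (\<integral>x. \<bar>g x - h x\<bar> / (1 + \<bar>g x - h x\<bar>) \<partial>I01)"
      by (simp add: integrable_frac m)
  qed
qed (simp_all add: uniformity_L0_def open_L0_def)

end

section \<open>Real vector space structure on functions\<close>

text \<open>The topology of \<open>nat \<Rightarrow> L0\<close> is the library's product topology on functions; the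
  additive group structure is the pointwise one of \<open>HOL-Library.Function_Algebras\<close>.\<close>

instantiation "fun" :: (type, real_vector) real_vector
begin

definition scaleR_fun :: "real \<Rightarrow> ('a \<Rightarrow> 'b) \<Rightarrow> 'a \<Rightarrow> 'b" where
  "scaleR_fun c f = (\<lambda>n. c *\<^sub>R f n)"

instance
  by standard
    (auto simp: scaleR_fun_def fun_eq_iff scaleR_add_right scaleR_add_left)

end

section \<open>The product metric on sequences\<close>

text \<open>The product topology on sequences in a metric space is induced by the metric
  \<open>\<Sum>n\<ge>1. 2\<^sup>-\<^sup>n \<rho>(f\<^sub>n, g\<^sub>n) / (1 + \<rho>(f\<^sub>n, g\<^sub>n))\<close>; it differs from the library's
  \<open>dist\<close> on functions.\<close>

definition seq_dist :: "(nat \<Rightarrow> 'a::metric_space) \<Rightarrow> (nat \<Rightarrow> 'a) \<Rightarrow> real" where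
  "seq_dist f g = (\<Sum>n. (1/2) ^ Suc n * (dist (f n) (g n) / (1 + dist (f n) (g n))))"

lemma seq_dist_term_le:
  "(1/2) ^ Suc n * (dist (f n) (g n) / (1 + dist (f n) (g n))) \<le> (1/2::real) ^ Suc n"
  using frac_le_1[of "dist (f n) (g n)"] by (intro mult_left_le) auto

lemma summable_half: "summable (\<lambda>n. (1/2::real) ^ Suc n)"
  using power_half_series by (rule sums_summable)

lemma seq_dist_summable:
  "summable (\<lambda>n. (1/2::real) ^ Suc n * (dist (f n) (g n) / (1 + dist (f n) (g n))))"
proof (rule summable_comparison_test'[OF summable_half])
  fix n :: nat
  have "norm ((1/2::real) ^ Suc n * (dist (f n) (g n) / (1 + dist (f n) (g n)))) =
      (1/2) ^ Suc n * (dist (f n) (g n) / (1 + dist (f n) (g n)))"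
    by (simp add: add_nonneg_nonneg)
  then show "norm ((1/2::real) ^ Suc n * (dist (f n) (g n) / (1 + dist (f n) (g n)))) \<le> (1/2) ^ Suc n"
    using seq_dist_term_le[of n f g] by linarith
qed

lemma open_iff_seq_dist:
  fixes U :: "(nat \<Rightarrow> 'a::metric_space) set"
  shows "open U \<longleftrightarrow> (\<forall>f\<in>U. \<exists>e>0. \<forall>g. seq_dist f g < e \<longrightarrow> g \<in> U)"
proof (intro iffI ballI)
  fix f assume "open U" "f \<in> U"
  then have "openin (product_topology (\<lambda>i. euclidean) UNIV) U"
    by (simp add: open_fun_def)
  from product_topology_open_contains_basis[OF this \<open>f \<in> U\<close>]
  obtain X where X: "f \<in> Pi\<^sub>E UNIV X" "\<And>i. open (X i)" "finite {i. X i \<noteq> UNIV}" "Pi\<^sub>E UNIV X \<subseteq> U"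
    by auto
  have "\<exists>e>0. ball (f i) e \<subseteq> X i" for i
    using X(1,2) open_contains_ball by blast
  then obtain e where e: "\<And>i. e i > 0" "\<And>i. ball (f i) (e i) \<subseteq> X i"
    by metis
  define I where "I = {i. X i \<noteq> UNIV}"
  define d where "d i = (1/2::real) ^ Suc i * (e i / (1 + e i))" for i
  have d: "d i > 0" for i
    using e(1)[of i] by (simp add: d_def)
  define m where "m = Min (insert 1 (d ` I))"
  have fin: "finite (insert 1 (d ` I))"
    using X(3) by (simp add: I_def)
  have "m > 0"
    using d fin by (simp add: m_def)
  moreover have "g \<in> U" if "seq_dist f g < m" for g
  proof -
    have "g i \<in> X i" for i
    proof (cases "i \<in> I")
      case True
      have "(1/2) ^ Suc i * (dist (f i) (g i) / (1 + dist (f i) (g i))) \<le> seq_dist f g"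
        unfolding seq_dist_def
        using sum_le_suminf[OF seq_dist_summable, of "{i}" f g] by simp
      also have "\<dots> < d i"
        using that True fin by (auto simp: m_def)
      finally have "dist (f i) (g i) / (1 + dist (f i) (g i)) < e i / (1 + e i)"
        unfolding d_def by (rule mult_left_less_imp_less) simp
      moreover have "0 < 1 + dist (f i) (g i)" "0 < 1 + e i"
        using e(1)[of i] zero_le_dist[of "f i" "g i"] by linarith+
      ultimately have "dist (f i) (g i) * (1 + e i) < e i * (1 + dist (f i) (g i))"
        by (simp add: divide_less_eq pos_less_divide_eq mult.commute)
      then have "dist (f i) (g i) < e i"
        by (simp add: algebra_simps)
      then show ?thesis
        using e(2)[of i] by auto
    qed (auto simp: I_def)
    then show ?thesis
      using X(4) by auto
  qed
  ultimately show "\<exists>e>0. \<forall>g. seq_dist f g < e \<longrightarrow> g \<in> U"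
    by (intro exI[of _ m] conjI allI impI)
next
  assume *: "\<forall>f\<in>U. \<exists>e>0. \<forall>g. seq_dist f g < e \<longrightarrow> g \<in> U"
  have "\<exists>V. open V \<and> f \<in> V \<and> V \<subseteq> U" if fU: "f \<in> U" for f
  proof -
    obtain e where e: "e > 0" "\<And>g. seq_dist f g < e \<Longrightarrow> g \<in> U"
      using bspec[OF * fU] by metis
    obtain N where N: "(1/2::real) ^ N < e / 2"
      using real_arch_pow_inv[of "e / 2" "1/2"] e(1) by auto
    define V where "V = {g. \<forall>i\<in>{..<N}. g i \<in> ball (f i) (e / 2)}"
    have "open V"
      unfolding V_def by (rule product_topology_basis') auto
    moreover have "f \<in> V"
      using e(1) by (simp add: V_def)
    moreover have "V \<subseteq> U"
    proof
      fix g assume g: "g \<in> V"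
      let ?t = "\<lambda>n. (1/2::real) ^ Suc n * (dist (f n) (g n) / (1 + dist (f n) (g n)))"
      have half: "(\<Sum>n. (1/2::real) ^ Suc n) = 1"
        using power_half_series by (rule sums_unique[symmetric])
      have head: "(\<Sum>n<N. ?t n) \<le> e / 2"
      proof -
        have "?t n \<le> (1/2) ^ Suc n * (e / 2)" if "n < N" for n
        proof (rule mult_left_mono)
          have "dist (f n) (g n) / (1 + dist (f n) (g n)) \<le> dist (f n) (g n) / 1"
            by (rule divide_left_mono) (auto simp: add_pos_nonneg)
          also have "\<dots> \<le> e / 2"
            using g that by (auto simp: V_def less_imp_le)
          finally show "dist (f n) (g n) / (1 + dist (f n) (g n)) \<le> e / 2" .
        qed simp
        then have "(\<Sum>n<N. ?t n) \<le> (\<Sum>n<N. (1/2) ^ Suc n * (e / 2))"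
          by (intro sum_mono) auto
        also have "\<dots> = (\<Sum>n<N. (1/2) ^ Suc n) * (e / 2)"
          by (simp only: sum_distrib_right)
        also have "\<dots> \<le> 1 * (e / 2)"
          using sum_le_suminf[OF summable_half, of "{..<N}"] half e(1)
          by (intro mult_right_mono) auto
        finally show ?thesis by simp
      qed
      have "(\<Sum>n. ?t (n + N)) \<le> (\<Sum>n. (1/2) ^ N * (1/2) ^ Suc n)"
      proof (rule suminf_le)
        show "?t (n + N) \<le> (1/2) ^ N * (1/2) ^ Suc n" for n
          using seq_dist_term_le[of "n + N" f g] by (simp add: power_add mult_ac)
        show "summable (\<lambda>n. ?t (n + N))"
          using seq_dist_summable[of f g] by (rule summable_ignore_initial_segment)
        show "summable (\<lambda>n. (1/2::real) ^ N * (1/2) ^ Suc n)"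
          using summable_half by (rule summable_mult)
      qed
      also have "\<dots> = (1/2) ^ N"
        using suminf_mult[OF summable_half, of "(1/2) ^ N"] half by simp
      finally have tail: "(\<Sum>n. ?t (n + N)) \<le> (1/2) ^ N" .
      have "seq_dist f g = (\<Sum>n. ?t (n + N)) + (\<Sum>n<N. ?t n)"
        unfolding seq_dist_def
        using seq_dist_summable[of f g] by (rule suminf_split_initial_segment)
      with head tail N have "seq_dist f g < e"
        by linarith
      then show "g \<in> U"
        by (rule e(2))
    qed
    ultimately show ?thesis by (intro exI[of _ V] conjI)
  qed
  then show "open U"
    using open_subopen[of U] by metis
qed

section \<open>Spaceability\<close>

definition infinite_dimensional :: "'a::real_vector set \<Rightarrow> bool" where
  "infinite_dimensional M \<longleftrightarrow> \<not> (\<exists>B. finite B \<and> B \<subseteq> M \<and> M \<subseteq> span B)"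

definition spaceable :: "'a::{real_vector, topological_space} set \<Rightarrow> bool" where
  "spaceable A \<longleftrightarrow>
     (\<exists>M. subspace M \<and> closed M \<and> infinite_dimensional M \<and> M - {0} \<subseteq> A)"

section \<open>Modes of convergence\<close>

lift_definition pointwise_ae :: "(nat \<Rightarrow> L0) \<Rightarrow> L0 \<Rightarrow> bool" is
  "\<lambda>F g. AE x in I01. (\<lambda>n. F n x) \<longlonglongrightarrow> g x"
proof -
  fix F G :: "nat \<Rightarrow> real \<Rightarrow> real" and f g
  assume "\<And>n. ae_eq01 (F n) (G n)" and "ae_eq01 f g"
  then have "AE x in I01. \<forall>n. F n x = G n x" "AE x in I01. f x = g x"
    by (auto simp: ae_eq01_def intro!: ae_eq01_common)
  then have "AE x in I01. ((\<lambda>n. F n x) \<longlonglongrightarrow> f x) = ((\<lambda>n. G n x) \<longlonglongrightarrow> g x)"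
    by eventually_elim simp
  then show "(AE x in I01. (\<lambda>n. F n x) \<longlonglongrightarrow> f x) = (AE x in I01. (\<lambda>n. G n x) \<longlonglongrightarrow> g x)"
    by (rule eventually_subst)
qed

lemma uniform_ae_transfer:
  assumes "\<And>n. ae_eq01 (F n) (G n)" "ae_eq01 f g"
    and "\<exists>E\<in>null_sets lebesgue. E \<subseteq> {0..1} \<and> uniform_limit ({0..1} - E) F f sequentially"
  shows "\<exists>E\<in>null_sets lebesgue. E \<subseteq> {0..1} \<and> uniform_limit ({0..1} - E) G g sequentially"
proof -
  obtain E where E: "E \<in> null_sets lebesgue" "E \<subseteq> {0..1}"
      "uniform_limit ({0..1} - E) F f sequentially"
    using assms(3) by auto
  have "AE x in I01. \<forall>n. F n x = G n x" "AE x in I01. f x = g x"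
    using assms(1,2) by (auto simp: ae_eq01_def intro!: ae_eq01_common)
  then have "AE x in I01. (\<forall>n. F n x = G n x) \<and> f x = g x"
    by eventually_elim simp
  then obtain N where N: "N \<in> null_sets I01"
      "{x \<in> space I01. \<not> ((\<forall>n. F n x = G n x) \<and> f x = g x)} \<subseteq> N"
    by (auto elim: AE_E3 simp: eventually_ae_filter)
  then have N': "N \<in> null_sets lebesgue" "N \<subseteq> {0..1}"
    by (auto simp: null_sets_restrict_space)
  have eq: "F n x = G n x" "f x = g x" if "x \<in> {0..1} - (E \<union> N)" for n x
    using N(2) that by auto
  have "uniform_limit ({0..1} - (E \<union> N)) F f sequentially"
    using E(3) by (rule uniform_limit_on_subset) auto
  then have "uniform_limit ({0..1} - (E \<union> N)) G g sequentially"
    by (subst (asm) uniform_limit_cong'[where g = G and i = g]) (auto simp: eq)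
  then show ?thesis
    using E N' by (intro bexI[of _ "E \<union> N"]) auto
qed

lift_definition uniformly_ae :: "(nat \<Rightarrow> L0) \<Rightarrow> L0 \<Rightarrow> bool" is
  "\<lambda>F g. \<exists>E\<in>null_sets lebesgue. E \<subseteq> {0..1} \<and> uniform_limit ({0..1} - E) F g sequentially"
proof (rule iffI)
  fix F G :: "nat \<Rightarrow> real \<Rightarrow> real" and f g
  assume FG: "\<And>n. ae_eq01 (F n) (G n)" and fg: "ae_eq01 f g"
  have GF: "\<And>n. ae_eq01 (G n) (F n)" and gf: "ae_eq01 g f"
    using FG fg by (auto intro: ae_eq01_sym)
  show "\<exists>E\<in>null_sets lebesgue. E \<subseteq> {0..1} \<and> uniform_limit ({0..1} - E) G g sequentially"
    if "\<exists>E\<in>null_sets lebesgue. E \<subseteq> {0..1} \<and> uniform_limit ({0..1} - E) F f sequentially"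
    using FG fg that by (rule uniform_ae_transfer)
  show "\<exists>E\<in>null_sets lebesgue. E \<subseteq> {0..1} \<and> uniform_limit ({0..1} - E) F f sequentially"
    if "\<exists>E\<in>null_sets lebesgue. E \<subseteq> {0..1} \<and> uniform_limit ({0..1} - E) G g sequentially"
    using GF gf that by (rule uniform_ae_transfer)
qed

text \<open>The library's \<open>esssup\<close> is valued in the extended reals; the following lemma gives it
  as an infimum over real bounds (with value \<open>\<infinity>\<close> when there is no real bound).\<close>

lemma esssup_lebesgue_on:
  assumes A: "A \<in> sets lebesgue" and f: "f \<in> borel_measurable (lebesgue_on A)"
  shows "esssup (lebesgue_on A) (\<lambda>x. ereal (f x)) =
    (INF \<alpha>\<in>{\<alpha>. emeasure lebesgue {x \<in> A. f x > \<alpha>} = 0}. ereal \<alpha>)"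
proof -
  have em: "emeasure (lebesgue_on A) {x \<in> A. P x} = emeasure lebesgue {x \<in> A. P x}" for P
    using A by (subst emeasure_restrict_space) (auto simp: space_restrict_space)
  have "esssup (lebesgue_on A) (\<lambda>x. ereal (f x)) =
      Inf {z. emeasure lebesgue {x \<in> A. ereal (f x) > z} = 0}"
    using f by (subst esssup_eq) (auto simp: em)
  also have "\<dots> = (INF \<alpha>\<in>{\<alpha>. emeasure lebesgue {x \<in> A. f x > \<alpha>} = 0}. ereal \<alpha>)"
  proof (rule antisym)
    show "Inf {z. emeasure lebesgue {x \<in> A. ereal (f x) > z} = 0} \<le>
        (INF \<alpha>\<in>{\<alpha>. emeasure lebesgue {x \<in> A. f x > \<alpha>} = 0}. ereal \<alpha>)"
      by (intro Inf_superset_mono) auto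
    show "(INF \<alpha>\<in>{\<alpha>. emeasure lebesgue {x \<in> A. f x > \<alpha>} = 0}. ereal \<alpha>) \<le>
        Inf {z. emeasure lebesgue {x \<in> A. ereal (f x) > z} = 0}"
    proof (rule Inf_greatest)
      fix z assume "z \<in> {z. emeasure lebesgue {x \<in> A. ereal (f x) > z} = 0}"
      then have z: "emeasure lebesgue {x \<in> A. ereal (f x) > z} = 0"
        by simp
      show "(INF \<alpha>\<in>{\<alpha>. emeasure lebesgue {x \<in> A. f x > \<alpha>} = 0}. ereal \<alpha>) \<le> z"
      proof (cases z)
        case (real r)
        with z show ?thesis
          by (intro INF_lower2[of r]) auto
      next
        case MInf
        with z have "emeasure lebesgue A = 0"
          by simp
        then have "A \<in> null_sets lebesgue"
          using A by auto
        then have "emeasure lebesgue {x \<in> A. f x > \<alpha>} = 0" for \<alpha>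
          using null_sets_completion_subset[of "{x \<in> A. f x > \<alpha>}" A lborel] by auto
        then have "(INF \<alpha>\<in>{\<alpha>. emeasure lebesgue {x \<in> A. f x > \<alpha>} = 0}. ereal \<alpha>) \<le> ereal r" for r
          by (intro INF_lower) auto
        then show ?thesis
          using MInf ereal_bot by auto
      qed auto
    qed
  qed
  finally show ?thesis .
qed

lift_definition almost_uniformly_null :: "(nat \<Rightarrow> L0) \<Rightarrow> bool" is
  "\<lambda>F. \<forall>\<epsilon>>0. \<exists>E\<in>sets lebesgue. E \<subseteq> {0..1} \<and> measure lebesgue E < \<epsilon> \<and>
     (\<lambda>n. esssup (lebesgue_on ({0..1} - E)) (\<lambda>x. ereal \<bar>F n x\<bar>)) \<longlonglongrightarrow> 0"
proof -
  fix F G :: "nat \<Rightarrow> real \<Rightarrow> real"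
  assume *: "\<And>n. ae_eq01 (F n) (G n)"
  have "esssup (lebesgue_on ({0..1} - E)) (\<lambda>x. ereal \<bar>F n x\<bar>) =
        esssup (lebesgue_on ({0..1} - E)) (\<lambda>x. ereal \<bar>G n x\<bar>)"
    if E: "E \<in> sets lebesgue" for E n
  proof (rule esssup_AE_cong)
    let ?A = "{0..1} - E :: real set"
    have A: "?A \<in> sets lebesgue"
      using E by auto
    have FG: "F n \<in> borel_measurable I01" "G n \<in> borel_measurable I01" "AE x in I01. F n x = G n x"
      using * by (auto simp: ae_eq01_def)
    have "F n \<in> borel_measurable (lebesgue_on ?A)" "G n \<in> borel_measurable (lebesgue_on ?A)"
      using FG(1,2) by (auto intro: measurable_restrict_mono)
    then show "(\<lambda>x. ereal \<bar>F n x\<bar>) \<in> borel_measurable (lebesgue_on ?A)"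
      "(\<lambda>x. ereal \<bar>G n x\<bar>) \<in> borel_measurable (lebesgue_on ?A)"
      by measurable
    show "AE x in lebesgue_on ?A. ereal \<bar>F n x\<bar> = ereal \<bar>G n x\<bar>"
      using FG(3) A by (auto simp: AE_restrict_space_iff elim!: eventually_mono)
  qed
  then show "(\<forall>\<epsilon>>0. \<exists>E\<in>sets lebesgue. E \<subseteq> {0..1} \<and> measure lebesgue E < \<epsilon> \<and>
     (\<lambda>n. esssup (lebesgue_on ({0..1} - E)) (\<lambda>x. ereal \<bar>F n x\<bar>)) \<longlonglongrightarrow> 0) =
   (\<forall>\<epsilon>>0. \<exists>E\<in>sets lebesgue. E \<subseteq> {0..1} \<and> measure lebesgue E < \<epsilon> \<and>
     (\<lambda>n. esssup (lebesgue_on ({0..1} - E)) (\<lambda>x. ereal \<bar>G n x\<bar>)) \<longlonglongrightarrow> 0)"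
    by (simp cong: bex_cong)
qed

definition NUP :: "(nat \<Rightarrow> L0) set" where
  "NUP = {f. pointwise_ae f 0 \<and> almost_uniformly_null f \<and> \<not> (\<exists>g. uniformly_ae f g)}"

end

theory Submission
  imports Defs
begin

text \<open>A single sequence of shrinking indicators already shows the gap between almost uniform and
  uniform convergence: the functions \<open>e\<^sub>n = 1\<close> on \<open>(0, 1/(n+1)]\<close>, zero elsewhere, vanish
  eventually off every neighbourhood of \<open>0\<close>, yet each of them equals \<open>1\<close> on a set of positive
  measure. Multiply each \<open>e\<^sub>n\<close> by a scalar \<open>c\<^sub>n\<close>: the first effect survives for arbitrary
  \<open>c\<^sub>n\<close>, and uniform convergence still fails if \<open>\<bar>c\<^sub>n\<bar>\<close> takes some fixed positive
  value infinitely often.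

  To force this on all nonzero members of a large vector space, split the index set \<open>\<nat>\<close> into
  infinitely many infinite blocks, the fibres of \<open>n \<mapsto> fst (prod_decode n)\<close>, and let the
  scalars be constant on each block. An arbitrary real sequence \<open>a\<close> thus gives the element
  \<open>bump_seq a\<close> of \<open>L\<^sub>0\<^sup>\<nat>\<close>, and if \<open>a i \<noteq> 0\<close> then \<open>\<bar>a i\<bar>\<close> recurs throughout block \<open>i\<close>
  (\<open>bump_seq_in_NUP\<close>). The space \<open>M\<close> is the range of this linear map.

  It is infinite-dimensional because the images of the unit sequences live on disjoint blocks.
  It is closed because the metric of \<open>L\<^sub>0\<close>, restricted to the line through \<open>e\<^sub>n\<close>, is an
  explicit increasing function of the distance between the scalars (\<open>dist_bump_seq\<close>): convergence in
  one coordinate of a block makes the corresponding scalars Cauchy, and their limit then governs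
  all coordinates of that block (\<open>closed_range_bump_seq\<close>).\<close>

section \<open>Shrinking bumps with blockwise constant heights\<close>

text \<open>Excluding \<open>0\<close> from the intervals makes the functions tend to \<open>0\<close> at every point,
  not only almost everywhere.\<close>

definition bump :: "(nat \<Rightarrow> real) \<Rightarrow> nat \<Rightarrow> real \<Rightarrow> real" where
  "bump a n x = a (fst (prod_decode n)) * indicator {0<..1 / real (Suc n)} x"

lemma borel_measurable_bump: "bump a n \<in> borel_measurable I01"
proof -
  have "bump a n \<in> borel_measurable borel"
    unfolding bump_def by measurable
  then show ?thesis
    by (intro measurable_restrict_space1 measurable_completion) simp
qed

lift_definition bump_seq :: "(nat \<Rightarrow> real) \<Rightarrow> nat \<Rightarrow> L0" is bump
  by (simp add: ae_eq01_def borel_measurable_bump)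

lemma bump_interval_subset: "{0<..1 / real (Suc n)} \<subseteq> {0..1}"
proof
  fix x assume x: "x \<in> {0<..1 / real (Suc n)}"
  then have "x \<le> 1 / real (Suc n)"
    by simp
  also have "\<dots> \<le> 1"
    by simp
  finally show "x \<in> {0..1}"
    using x by simp
qed

lemma bump_eq_0:
  assumes "1 / real (Suc n) < x"
  shows "bump a n x = 0"
  using assms by (simp add: bump_def)

section \<open>Modes of convergence\<close>

lemma bump_tendsto_0: "(\<lambda>n. bump a n x) \<longlonglongrightarrow> 0"
proof (cases "x > 0")
  case True
  have "(\<lambda>n. 1 / real (Suc n)) \<longlonglongrightarrow> 0"
    by (rule LIMSEQ_Suc[OF lim_1_over_n])
  then have "\<forall>\<^sub>F n in sequentially. 1 / real (Suc n) < x"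
    using True by (rule order_tendstoD)
  then have "\<forall>\<^sub>F n in sequentially. bump a n x = 0"
    by eventually_elim (rule bump_eq_0)
  then show ?thesis
    by (rule tendsto_eventually)
qed (simp add: bump_def)

lemma pointwise_ae_bump_seq: "pointwise_ae (bump_seq a) 0"
  by transfer (simp add: bump_tendsto_0)

text \<open>The exceptional set can be taken to be a short interval at \<open>0\<close>: off it, all but finitely
  many members of the sequence vanish identically.\<close>

lemma almost_uniformly_null_bump_seq: "almost_uniformly_null (bump_seq a)"
proof (transfer, intro allI impI)
  fix a :: "nat \<Rightarrow> real" and \<epsilon> :: real
  assume "\<epsilon> > 0"
  \<comment> \<open>The bound \<open>\<delta> < 1\<close> leaves a complement of positive measure; on a null set the essential
    supremum would be \<open>-\<infinity>\<close> rather than \<open>0\<close>.\<close>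
  define \<delta> where "\<delta> = min (\<epsilon> / 2) (1 / 2)"
  have \<delta>: "0 < \<delta>" "\<delta> < \<epsilon>" "\<delta> < 1"
    using \<open>\<epsilon> > 0\<close> by (auto simp: \<delta>_def)
  let ?A = "{0..1} - {0..\<delta>}"
  have A: "?A = {\<delta><..1}"
    using \<delta> by auto
  have nz: "emeasure (lebesgue_on ?A) (space (lebesgue_on ?A)) \<noteq> 0"
    using \<delta> by (simp add: A space_restrict_space emeasure_restrict_space)
  have "(\<lambda>n. 1 / real (Suc n)) \<longlonglongrightarrow> 0"
    by (rule LIMSEQ_Suc[OF lim_1_over_n])
  then have "\<forall>\<^sub>F n in sequentially. 1 / real (Suc n) < \<delta>"
    using \<delta>(1) by (rule order_tendstoD)
  then have "\<forall>\<^sub>F n in sequentially. esssup (lebesgue_on ?A) (\<lambda>x. ereal \<bar>bump a n x\<bar>) = 0"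
  proof eventually_elim
    case (elim n)
    have "esssup (lebesgue_on ?A) (\<lambda>x. ereal \<bar>bump a n x\<bar>) = esssup (lebesgue_on ?A) (\<lambda>x. 0)"
    proof (rule esssup_AE_cong)
      have "\<bar>bump a n x\<bar> = 0" if "x \<in> ?A" for x
        using that elim bump_eq_0[of n x a] by (auto simp del: of_nat_Suc)
      then show "AE x in lebesgue_on ?A. ereal \<bar>bump a n x\<bar> = 0"
        by (intro AE_I2) (simp add: space_restrict_space)
      have "bump a n \<in> borel_measurable (lebesgue_on ?A)"
        using borel_measurable_bump by (rule measurable_restrict_mono) auto
      then show "(\<lambda>x. ereal \<bar>bump a n x\<bar>) \<in> borel_measurable (lebesgue_on ?A)"
        by measurable
    qed simp
    also have "\<dots> = 0"
      using nz by (rule esssup_const)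
    finally show ?case .
  qed
  then have "(\<lambda>n. esssup (lebesgue_on ?A) (\<lambda>x. ereal \<bar>bump a n x\<bar>)) \<longlonglongrightarrow> 0"
    by (rule tendsto_eventually)
  then show "\<exists>E\<in>sets lebesgue. E \<subseteq> {0..1} \<and> measure lebesgue E < \<epsilon> \<and>
      (\<lambda>n. esssup (lebesgue_on ({0..1} - E)) (\<lambda>x. ereal \<bar>bump a n x\<bar>)) \<longlonglongrightarrow> 0"
    using \<delta> by (intro bexI[of _ "{0..\<delta>}"]) auto
qed

text \<open>A uniform limit off a null set must agree with the pointwise limit \<open>0\<close>. But block \<open>i\<close>
  contains arbitrarily large indices, namely \<open>prod_encode (i, N) \<ge> N\<close>, at which the value
  \<open>a i\<close> is attained on a set of positive measure.\<close>

lemma not_uniformly_ae_bump_seq: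
  assumes "a i \<noteq> 0"
  shows "\<not> uniformly_ae (bump_seq a) g"
  using assms
proof (transfer fixing: i, intro notI)
  fix a :: "nat \<Rightarrow> real" and g :: "real \<Rightarrow> real"
  assume ai: "a i \<noteq> 0"
    and "\<exists>E\<in>null_sets lebesgue. E \<subseteq> {0..1} \<and> uniform_limit ({0..1} - E) (bump a) g sequentially"
  then obtain E where E: "E \<in> null_sets lebesgue"
      and lim: "uniform_limit ({0..1} - E) (bump a) g sequentially"
    by blast
  have g0: "g x = 0" if "x \<in> {0..1} - E" for x
    using tendsto_uniform_limitI[OF lim that] bump_tendsto_0 by (rule LIMSEQ_unique)
  obtain N where N: "\<And>n x. n \<ge> N \<Longrightarrow> x \<in> {0..1} - E \<Longrightarrow> dist (bump a n x) (g x) < \<bar>a i\<bar>"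
    using uniform_limitD[OF lim, of "\<bar>a i\<bar>"] ai unfolding eventually_sequentially by (metis zero_less_abs_iff)
  define n where "n = prod_encode (i, N)"
  have "\<not> {0<..1 / real (Suc n)} \<subseteq> E"
  proof
    assume "{0<..1 / real (Suc n)} \<subseteq> E"
    then have "{0<..1 / real (Suc n)} \<in> null_sets lebesgue"
      using E null_sets_completion_subset by blast
    then have "emeasure lebesgue {0<..1 / real (Suc n)} = 0"
      by (rule null_setsD1)
    then show False
      by simp
  qed
  then obtain x where x: "x \<in> {0<..1 / real (Suc n)}" "x \<notin> E"
    by blast
  then have x01: "x \<in> {0..1} - E"
    using bump_interval_subset[of n] by blast
  have "bump a n x = a i"
    using x(1) by (simp add: bump_def n_def)
  then show False
    using N[OF _ x01, of n] g0[OF x01] le_prod_encode_2[of N i] by (simp add: n_def)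
qed

lemma bump_seq_in_NUP:
  assumes "a i \<noteq> 0"
  shows "bump_seq a \<in> NUP"
  using assms pointwise_ae_bump_seq almost_uniformly_null_bump_seq not_uniformly_ae_bump_seq
  by (auto simp: NUP_def)

section \<open>Linearity and the metric along a coordinate\<close>

lemma bump_seq_add: "bump_seq (a + b) = bump_seq a + bump_seq b"
proof
  fix n
  have "bump_seq (\<lambda>i. a i + b i) n = bump_seq a n + bump_seq b n"
    proof transfer
    fix a b n
    have "bump (\<lambda>i. a i + b i) n = (\<lambda>x. bump a n x + bump b n x)"
      by (simp add: bump_def fun_eq_iff distrib_right)
    then show "ae_eq01 (bump (\<lambda>i. a i + b i) n) (\<lambda>x. bump a n x + bump b n x)"
      using borel_measurable_bump[of "\<lambda>i. a i + b i" n] by (simp add: ae_eq01_def)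
  qed
  then show "bump_seq (a + b) n = (bump_seq a + bump_seq b) n"
    by (simp add: plus_fun_def)
qed

lemma bump_seq_scaleR: "bump_seq (c *\<^sub>R a) = c *\<^sub>R bump_seq a"
proof
  fix n
  have "bump_seq (\<lambda>i. c * a i) n = c *\<^sub>R bump_seq a n"
    proof transfer
    fix c :: real and a n
    have "bump (\<lambda>i. c * a i) n = (\<lambda>x. c * bump a n x)"
      by (simp add: bump_def fun_eq_iff)
    then show "ae_eq01 (bump (\<lambda>i. c * a i) n) (\<lambda>x. c * bump a n x)"
      using borel_measurable_bump[of "\<lambda>i. c * a i" n] by (simp add: ae_eq01_def)
  qed
  then show "bump_seq (c *\<^sub>R a) n = (c *\<^sub>R bump_seq a) n"
    by (simp add: scaleR_fun_def)
qed

lemma linear_bump_seq: "linear bump_seq"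
  by (intro linearI bump_seq_add bump_seq_scaleR)

text \<open>Along each coordinate the metric sees only the difference of the two scalars, through a
  function that is a homeomorphism onto its image; this is what makes the coordinate lines of the
  range complete.\<close>

lemma dist_bump_seq:
  fixes a b :: "nat \<Rightarrow> real" and n :: nat
  defines "t \<equiv> \<bar>a (fst (prod_decode n)) - b (fst (prod_decode n))\<bar>"
  shows "dist (bump_seq a n) (bump_seq b n) = t / (1 + t) / real (Suc n)"
  unfolding t_def
proof transfer
  fix a b :: "nat \<Rightarrow> real" and n :: nat
  let ?t = "\<bar>a (fst (prod_decode n)) - b (fst (prod_decode n))\<bar>"
  let ?J = "{0<..1 / real (Suc n)}"
  note J = bump_interval_subset[of n]
  have "(\<integral>x. \<bar>bump a n x - bump b n x\<bar> / (1 + \<bar>bump a n x - bump b n x\<bar>) \<partial>I01) =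
      (\<integral>x. ?t / (1 + ?t) * indicator ?J x \<partial>I01)"
    by (intro Bochner_Integration.integral_cong) (auto simp: bump_def indicator_def)
  also have "\<dots> = ?t / (1 + ?t) * measure I01 ?J"
    using J by (simp add: space_restrict_space Int_absorb2)
  also have "measure I01 ?J = 1 / real (Suc n)"
    using J by (subst measure_restrict_space) auto
  finally show "(\<integral>x. \<bar>bump a n x - bump b n x\<bar> / (1 + \<bar>bump a n x - bump b n x\<bar>) \<partial>I01) =
      ?t / (1 + ?t) / real (Suc n)"
    by simp
qed

lemma bump_seq_eq_0_iff: "bump_seq a n = 0 \<longleftrightarrow> a (fst (prod_decode n)) = 0"
proof -
  let ?t = "\<bar>a (fst (prod_decode n))\<bar>"
  have "bump_seq 0 n = 0"
    by (simp add: linear_0[OF linear_bump_seq])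
  then have "dist (bump_seq a n) 0 = ?t / (1 + ?t) / real (Suc n)"
    using dist_bump_seq[of a n 0] by simp
  then have "bump_seq a n = 0 \<longleftrightarrow> ?t / (1 + ?t) / real (Suc n) = 0"
    by (metis dist_eq_0_iff)
  then show ?thesis
    by (simp add: add_nonneg_eq_0_iff)
qed

section \<open>Closedness\<close>

lemma frac_less_imp_less:
  fixes s t :: real
  assumes "s / (1 + s) < t / (1 + t)" "0 \<le> s" "0 \<le> t"
  shows "s < t"
proof (rule ccontr)
  assume "\<not> s < t"
  then have "t / (1 + t) \<le> s / (1 + s) + 0 / (1 + 0)"
    using assms(2,3) by (intro frac_triangle) auto
  then show False
    using assms(1) by simp
qed

text \<open>The index \<open>prod_encode (i, 0)\<close> serves as a representative of block \<open>i\<close>: the scalars are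
  recovered from the coordinates at these indices, and the other coordinates are then forced.\<close>

lemma closed_range_bump_seq: "closed (range bump_seq)"
  unfolding closed_sequential_limits
proof (intro allI impI, elim conjE)
  fix F :: "nat \<Rightarrow> nat \<Rightarrow> L0" and f
  assume ran: "\<forall>k. F k \<in> range bump_seq" and lim: "F \<longlonglongrightarrow> f"
  have coord: "(\<lambda>k. F k n) \<longlonglongrightarrow> f n" for n
    by (rule continuous_on_tendsto_compose[OF continuous_on_product_coordinates lim]) auto
  have "\<forall>k. \<exists>a. F k = bump_seq a"
    using ran by blast
  from choice[OF this] obtain c where F: "\<And>k. F k = bump_seq (c k)"
    by blast
  have "Cauchy (\<lambda>k. c k i)" for i
  proof (rule metric_CauchyI)
    fix e :: real assume e: "e > 0"
    define n where "n = prod_encode (i, 0)"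
    have "Cauchy (\<lambda>k. F k n)"
      using coord by (rule LIMSEQ_imp_Cauchy)
    moreover have "e / (1 + e) / real (Suc n) > 0"
      using e by simp
    ultimately obtain K where K: "\<And>k l. k \<ge> K \<Longrightarrow> l \<ge> K \<Longrightarrow>
        dist (F k n) (F l n) < e / (1 + e) / real (Suc n)"
      by (meson metric_CauchyD)
    have "dist (c k i) (c l i) < e" if "k \<ge> K" "l \<ge> K" for k l
    proof -
      have "dist (c k i) (c l i) / (1 + dist (c k i) (c l i)) / real (Suc n)
          < e / (1 + e) / real (Suc n)"
        using K[OF that] by (simp add: F dist_bump_seq n_def dist_real_def)
      then have "dist (c k i) (c l i) / (1 + dist (c k i) (c l i)) < e / (1 + e)"
        by (simp only: divide_less_cancel)
      then show ?thesis
        by (rule frac_less_imp_less) (use e in auto)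
    qed
    then show "\<exists>K. \<forall>k\<ge>K. \<forall>l\<ge>K. dist (c k i) (c l i) < e"
      by blast
  qed
  then have "convergent (\<lambda>k. c k i)" for i
    by (rule Cauchy_convergent)
  then have "\<forall>i. \<exists>l. (\<lambda>k. c k i) \<longlonglongrightarrow> l"
    by (simp add: convergent_def)
  from choice[OF this] obtain d where d: "\<And>i. (\<lambda>k. c k i) \<longlonglongrightarrow> d i"
    by blast
  have "f n = bump_seq d n" for n
  proof (rule LIMSEQ_unique[OF coord])
    let ?i = "fst (prod_decode n)"
    have "(\<lambda>k. \<bar>c k ?i - d ?i\<bar> / (1 + \<bar>c k ?i - d ?i\<bar>) / real (Suc n))
        \<longlonglongrightarrow> \<bar>d ?i - d ?i\<bar> / (1 + \<bar>d ?i - d ?i\<bar>) / real (Suc n)"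
      by (intro tendsto_intros d) auto
    then have "(\<lambda>k. dist (F k n) (bump_seq d n)) \<longlonglongrightarrow> 0"
      by (simp add: F dist_bump_seq)
    then show "(\<lambda>k. F k n) \<longlonglongrightarrow> bump_seq d n"
      by (rule tendsto_dist_iff[THEN iffD2])
  qed
  then show "f \<in> range bump_seq"
    by (auto simp: fun_eq_iff)
qed

section \<open>Infinite dimension and spaceability\<close>

text \<open>Among the images of the unit sequences, only the \<open>i\<close>-th is nonzero at the coordinate
  \<open>prod_encode (i, 0)\<close>, so none of them is a combination of the others.\<close>

lemma infinite_dimensional_range_bump_seq: "infinite_dimensional (range bump_seq)"
proof -
  define u where "u i = bump_seq (\<lambda>j. if j = i then 1 else 0)" for i
  have u_neq_0: "u i (prod_encode (i, 0)) \<noteq> 0" for i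
    by (simp add: u_def bump_seq_eq_0_iff)
  have u_eq_0: "u j (prod_encode (i, 0)) = 0" if "j \<noteq> i" for i j
    using that by (simp add: u_def bump_seq_eq_0_iff)
  have inj: "inj u"
    by (rule injI) (metis u_neq_0 u_eq_0)
  have "independent (range u)"
    unfolding dependent_def
  proof (intro notI, elim bexE)
    fix v assume "v \<in> range u" and v: "v \<in> span (range u - {v})"
    then obtain i where i: "v = u i"
      by blast
    have "span (range u - {v}) \<subseteq> {f. f (prod_encode (i, 0)) = 0}"
      by (rule span_minimal)
        (auto simp: i subspace_def scaleR_fun_def intro!: u_eq_0)
    then show False
      using v u_neq_0[of i] i by auto
  qed
  then have "\<not> range u \<subseteq> span B" if "finite B" for B
    using independent_span_bound[OF that] range_inj_infinite[OF inj] by blast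
  moreover have "range u \<subseteq> range bump_seq"
    by (auto simp: u_def)
  ultimately show ?thesis
    unfolding infinite_dimensional_def by blast
qed

theorem theorem3p4:
  shows "spaceable NUP"
proof -
  have "subspace (range bump_seq)"
    by (rule linear_subspace_image[OF linear_bump_seq subspace_UNIV])
  moreover have "f \<in> NUP" if f: "f \<in> range bump_seq - {0}" for f
  proof -
    obtain a where a: "f = bump_seq a"
      using f by blast
    have "a \<noteq> 0"
      using f linear_0[OF linear_bump_seq] by (auto simp: a)
    then obtain i where "a i \<noteq> 0"
      by (auto simp: fun_eq_iff)
    then show ?thesis
      unfolding a by (rule bump_seq_in_NUP)
  qed
  ultimately show ?thesis
    unfolding spaceable_def
    using closed_range_bump_seq infinite_dimensional_range_bump_seq by blast
qed

end
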